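(* Let $T$ be a propositional theory over $\mathcal V$, let $(\mathcal A,\oplus,\otimes,e^\oplus,e^\otimes)$ be a commutative semiring whose addition $\oplus$ is idempotent (i.e. $a\oplus a=a$ for all $a\in\mathcal A$), and let $\alpha:\mathcal L\to\mathcal A$ be a labeling function on the literals of $\mathcal V$. If $N_T$ is an s-DNNF representation of $T$ (i.e. an NNF circuit that is smooth and decomposable, is logically equivalent to $T$, and whose set of variables is $\mathcal V$), then evaluating $N_T$ is a sound AMC computation, i.e. $$\mathrm{Eval}(N_T,\oplus,\otimes,e^\oplus,e^\otimes,\alpha)=\mathbf A(T).$$
   Context: A semiring $(\mathcal A,\oplus,\otimes,e^\oplus,e^\otimes)$ has associative binary operations $\oplus,\otimes$ on $\mathcal A$, with $\oplus$ commutative, $\otimes$ distributing over $\oplus$, $e^\oplus$ neutral for $\oplus$, $e^\otimes$ neutral for $\otimes$, and $e^\oplus\otimes a=a\otimes e^\oplus=e^\oplus$ for all $a$. It is commutative if $\otimes$ is also commutative. Algebraic model count: for a propositional theory $T$ over a finite set $\mathcal V$ of variables and $\alpha:\mathcal L\to\mathcal A$ on the set $\mathcal L$ of literals of $\mathcal V$, $$\mathbf A(T)=\bigoplus_{I\in\mathcal M(T)}\ \bigotimes_{l\in I}\alpha(l),$$ where $\mathcal M(T)$ is the set of models of $T$; a model is a set of literals containing exactly one of $v,\neg v$ for each $v\in\mathcal V$. Empty sums are $e^\oplus$, empty products $e^\otimes$. An NNF circuit over $\mathcal V$ is a finite rooted directed acyclic graph whose leaves are labeled with $\top$, $\bot$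 or a literal of a variable in $\mathcal V$, and whose internal nodes are labeled $\vee$ or $\wedge$. Each node is identified with the formula of the subcircuit rooted at it, and its variables are those occurring in that subcircuit. The circuit is decomposable if for each conjunction node $\bigwedge_{i=1}^n\phi_i$ no two children $\phi_i,\phi_j$ ($i\ne j$) share a variable; smooth if for each disjunction node $\bigvee_{i=1}^n\phi_i$ all children mention the same set of variables. $\mathrm{Eval}$ is defined recursively from the leaves to the root: $\top\mapsto e^\otimes$, $\bot\mapsto e^\oplus$, literal $l\mapsto\alpha(l)$, a disjunction node $\mapsto$ the $\oplus$-sum of the values of its children, a conjunction node $\mapsto$ the $\otimes$-product of the values of its children; the value of the circuit is that of its root. *)

theory Defs
  imports Main
begin

datatype 'v literal = PosLit 'v | NegLit 'v

primrec lit_var :: "'v literal \<Rightarrow> 'v" where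
  "lit_var (PosLit v) = v"
| "lit_var (NegLit v) = v"

datatype 'v form =
    FTop
  | FBot
  | Atom 'v
  | FNot "'v form"
  | FAnd "'v form" "'v form"
  | FOr "'v form" "'v form"
  | FImp "'v form" "'v form"
  | FIff "'v form" "'v form"

definition theory_over :: "'v set \<Rightarrow> 'v form set \<Rightarrow> bool" where
  "theory_over V T \<longleftrightarrow> (\<forall>\<phi>\<in>T. set_form \<phi> \<subseteq> V)"

definition interpretations :: "'v set \<Rightarrow> 'v literal set set" where
  "interpretations V =
    {I. lit_var ` I \<subseteq> V \<and> (\<forall>v\<in>V. PosLit v \<in> I \<longleftrightarrow> NegLit v \<notin> I)}"

primrec sat :: "'v literal set \<Rightarrow> 'v form \<Rightarrow> bool" where
  "sat I FTop = True"
| "sat I FBot = False"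
| "sat I (Atom v) = (PosLit v \<in> I)"
| "sat I (FNot \<phi>) = (\<not> sat I \<phi>)"
| "sat I (FAnd \<phi> \<psi>) = (sat I \<phi> \<and> sat I \<psi>)"
| "sat I (FOr \<phi> \<psi>) = (sat I \<phi> \<or> sat I \<psi>)"
| "sat I (FImp \<phi> \<psi>) = (sat I \<phi> \<longrightarrow> sat I \<psi>)"
| "sat I (FIff \<phi> \<psi>) = (sat I \<phi> \<longleftrightarrow> sat I \<psi>)"

definition models :: "'v set \<Rightarrow> 'v form set \<Rightarrow> 'v literal set set" where
  "models V T = {I \<in> interpretations V. \<forall>\<phi>\<in>T. sat I \<phi>}"

text \<open>
  The sort \<open>{comm_semiring_0, comm_monoid_mult}\<close> is exactly that of commutative semirings with
  neutral elements \<open>0\<close> and \<open>1\<close>, where \<open>0\<close> is absorbing.  The class \<open>comm_semiring_1\<close> would in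
  addition require \<open>0 \<noteq> 1\<close> and thus exclude the one-element semiring.
\<close>

definition amc ::
  "'v set \<Rightarrow> ('v literal \<Rightarrow> 'a::{comm_semiring_0, comm_monoid_mult}) \<Rightarrow> 'v form set \<Rightarrow> 'a"
where
  "amc V \<alpha> T = (\<Sum>I\<in>models V T. \<Prod>l\<in>I. \<alpha> l)"


datatype 'v node_label = LTop | LBot | LLit "'v literal" | LOr | LAnd

text \<open>An edge \<open>(n, m)\<close> leads from the node \<open>n\<close> to its child \<open>m\<close>.\<close>

record ('n, 'v) circuit =
  nodes :: "'n set"
  edges :: "('n \<times> 'n) set"
  root_node :: 'n
  label :: "'n \<Rightarrow> 'v node_label"

definition children :: "('n, 'v) circuit \<Rightarrow> 'n \<Rightarrow> 'n set" where
  "children N n = edges N `` {n}"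

definition nnf_circuit :: "'v set \<Rightarrow> ('n, 'v) circuit \<Rightarrow> bool" where
  "nnf_circuit V N \<longleftrightarrow>
     finite (nodes N) \<and> edges N \<subseteq> nodes N \<times> nodes N \<and> acyclic (edges N) \<and>
     root_node N \<in> nodes N \<and> (\<forall>n\<in>nodes N. (root_node N, n) \<in> (edges N)\<^sup>*) \<and>
     (\<forall>n\<in>nodes N.
        if children N n = {}
        then label N n \<in> {LTop, LBot} \<union> LLit ` {l. lit_var l \<in> V}
        else label N n \<in> {LOr, LAnd})"

definition node_vars :: "('n, 'v) circuit \<Rightarrow> 'n \<Rightarrow> 'v set" where
  "node_vars N n = {lit_var l | l m. (n, m) \<in> (edges N)\<^sup>* \<and> label N m = LLit l}"

definition decomposable :: "('n, 'v) circuit \<Rightarrow> bool" where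
  "decomposable N \<longleftrightarrow>
     (\<forall>n\<in>nodes N. label N n = LAnd \<longrightarrow>
        (\<forall>m\<in>children N n. \<forall>k\<in>children N n. m \<noteq> k \<longrightarrow> node_vars N m \<inter> node_vars N k = {}))"

definition smooth :: "('n, 'v) circuit \<Rightarrow> bool" where
  "smooth N \<longleftrightarrow>
     (\<forall>n\<in>nodes N. label N n = LOr \<longrightarrow>
        (\<forall>m\<in>children N n. \<forall>k\<in>children N n. node_vars N m = node_vars N k))"

text \<open>
  Satisfaction and evaluation of nodes are defined by well-founded recursion from a node to its
  children.  On finite acyclic circuits they satisfy the expected recursion equations
  (\<open>node_sat_rec\<close> and \<open>node_eval_rec\<close> below).
\<close>

definition node_sat :: "('n, 'v) circuit \<Rightarrow> 'v literal set \<Rightarrow> 'n \<Rightarrow> bool" where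
  "node_sat N I = wfrec ((edges N)\<inverse>) (\<lambda>f n.
     case label N n of
       LTop \<Rightarrow> True
     | LBot \<Rightarrow> False
     | LLit l \<Rightarrow> l \<in> I
     | LOr \<Rightarrow> (\<exists>m\<in>children N n. f m)
     | LAnd \<Rightarrow> (\<forall>m\<in>children N n. f m))"

definition node_eval ::
  "('n, 'v) circuit \<Rightarrow> ('v literal \<Rightarrow> 'a::{comm_semiring_0, comm_monoid_mult}) \<Rightarrow> 'n \<Rightarrow> 'a"
where
  "node_eval N \<alpha> = wfrec ((edges N)\<inverse>) (\<lambda>f n.
     case label N n of
       LTop \<Rightarrow> 1
     | LBot \<Rightarrow> 0
     | LLit l \<Rightarrow> \<alpha> l
     | LOr \<Rightarrow> (\<Sum>m\<in>children N n. f m)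
     | LAnd \<Rightarrow> (\<Prod>m\<in>children N n. f m))"

lemma nnf_circuit_wf:
  assumes "nnf_circuit V N"
  shows "wf ((edges N)\<inverse>)"
proof (rule finite_acyclic_wf_converse)
  show "finite (edges N)"
    using assms unfolding nnf_circuit_def by (meson finite_SigmaI finite_subset)
  show "acyclic (edges N)"
    using assms unfolding nnf_circuit_def by blast
qed

lemma node_sat_rec:
  assumes "nnf_circuit V N"
  shows "node_sat N I n = (case label N n of
       LTop \<Rightarrow> True
     | LBot \<Rightarrow> False
     | LLit l \<Rightarrow> l \<in> I
     | LOr \<Rightarrow> (\<exists>m\<in>children N n. node_sat N I m)
     | LAnd \<Rightarrow> (\<forall>m\<in>children N n. node_sat N I m))"
  unfolding node_sat_def
  by (subst wfrec[OF nnf_circuit_wf[OF assms]])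
     (simp add: cut_def children_def split: node_label.split)

lemma node_eval_rec:
  assumes "nnf_circuit V N"
  shows "node_eval N \<alpha> n = (case label N n of
       LTop \<Rightarrow> 1
     | LBot \<Rightarrow> 0
     | LLit l \<Rightarrow> \<alpha> l
     | LOr \<Rightarrow> (\<Sum>m\<in>children N n. node_eval N \<alpha> m)
     | LAnd \<Rightarrow> (\<Prod>m\<in>children N n. node_eval N \<alpha> m))"
  unfolding node_eval_def
  by (subst wfrec[OF nnf_circuit_wf[OF assms]])
     (auto simp: cut_def children_def split: node_label.split intro!: sum.cong prod.cong)

definition Eval ::
  "('n, 'v) circuit \<Rightarrow> ('v literal \<Rightarrow> 'a::{comm_semiring_0, comm_monoid_mult}) \<Rightarrow> 'a"
where
  "Eval N \<alpha> = node_eval N \<alpha> (root_node N)"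

definition circuit_models :: "'v set \<Rightarrow> ('n, 'v) circuit \<Rightarrow> 'v literal set set" where
  "circuit_models V N = {I \<in> interpretations V. node_sat N I (root_node N)}"

definition sdnnf_representation :: "'v set \<Rightarrow> 'v form set \<Rightarrow> ('n, 'v) circuit \<Rightarrow> bool" where
  "sdnnf_representation V T N \<longleftrightarrow>
     nnf_circuit V N \<and> smooth N \<and> decomposable N \<and>
     circuit_models V N = models V T \<and> node_vars N (root_node N) = V"

end

theory Submission
  imports Defs
begin

text \<open>
  The value of every node \<open>n\<close> is the model count of its subformula over the variables of \<open>n\<close>;
  this goes by induction from the leaves.  At a conjunction, decomposability makes the models
  exactly the disjoint unions of models of the children, so distributivity applies.  At a
  disjunction, smoothness makes the models the plain union of the models of the children.  This
  union need not be disjoint, but idempotence absorbs the models counted repeatedly.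
\<close>

section \<open>Sums under idempotent addition\<close>

lemma sum_Un_idem:
  fixes f :: "'b \<Rightarrow> 'a::comm_monoid_add"
  assumes idem: "\<And>a :: 'a. a + a = a" and fin: "finite A" "finite B"
  shows "sum f (A \<union> B) = sum f A + sum f B"
proof -
  have "sum f (A \<union> B) = sum f (A \<union> B - A \<inter> B) + sum f (A \<inter> B)"
    using fin by (intro sum.subset_diff) auto
  also have "\<dots> = sum f (A \<union> B - A \<inter> B) + sum f (A \<inter> B) + sum f (A \<inter> B)"
    by (simp add: idem add.assoc)
  also have "\<dots> = sum f (A \<union> B) + sum f (A \<inter> B)"
    using fin by (subst (2) sum.subset_diff[of "A \<inter> B"]) auto
  also have "\<dots> = sum f A + sum f B"
    using fin by (rule sum.union_inter)
  finally show ?thesis .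
qed

lemma sum_UN_idem:
  fixes f :: "'b \<Rightarrow> 'a::comm_monoid_add"
  assumes idem: "\<And>a :: 'a. a + a = a" and "finite F" "\<And>m. m \<in> F \<Longrightarrow> finite (S m)"
  shows "sum f (\<Union>m\<in>F. S m) = (\<Sum>m\<in>F. sum f (S m))"
  using assms(2,3) by (induction F) (auto simp: sum_Un_idem[OF idem])

section \<open>Model counts of predicates and the combination of interpretations\<close>

text \<open>A variant of \<open>amc\<close> with a predicate in place of the theory, so that each
  circuit node can be counted over its own variables.\<close>

definition count_models ::
  "'v set \<Rightarrow> ('v literal \<Rightarrow> 'a::{comm_semiring_0, comm_monoid_mult}) \<Rightarrow> ('v literal set \<Rightarrow> bool) \<Rightarrow> 'a"
where
  "count_models W \<alpha> P = (\<Sum>I | I \<in> interpretations W \<and> P I. \<Prod>l\<in>I. \<alpha> l)"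

definition restrict_lits :: "'v set \<Rightarrow> 'v literal set \<Rightarrow> 'v literal set" where
  "restrict_lits W I = {l \<in> I. lit_var l \<in> W}"

lemma finite_lits: "finite W \<Longrightarrow> finite {l. lit_var l \<in> W}"
proof (rule finite_subset)
  show "{l. lit_var l \<in> W} \<subseteq> PosLit ` W \<union> NegLit ` W"
  proof
    fix l assume "l \<in> {l. lit_var l \<in> W}"
    then show "l \<in> PosLit ` W \<union> NegLit ` W" by (cases l) auto
  qed
qed simp

lemma interpretation_subset: "I \<in> interpretations W \<Longrightarrow> I \<subseteq> {l. lit_var l \<in> W}"
  by (auto simp: interpretations_def)

lemma finite_interpretation: "finite W \<Longrightarrow> I \<in> interpretations W \<Longrightarrow> finite I"
  using finite_lits interpretation_subset finite_subset by metis

lemma finite_interpretations: "finite W \<Longrightarrow> finite (interpretations W)"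
  by (rule finite_subset[of _ "Pow {l. lit_var l \<in> W}"])
     (auto simp: finite_lits dest: interpretation_subset)

lemma interpretations_empty: "interpretations {} = {{}}"
  by (auto simp: interpretations_def)

lemma interpretations_singleton: "interpretations {v} = {{PosLit v}, {NegLit v}}"
proof (intro equalityI subsetI)
  fix I assume I: "I \<in> interpretations {v}"
  have "I \<subseteq> {PosLit v, NegLit v}"
  proof
    fix l assume "l \<in> I"
    then show "l \<in> {PosLit v, NegLit v}"
      using interpretation_subset[OF I] by (cases l) auto
  qed
  moreover have "PosLit v \<in> I \<longleftrightarrow> NegLit v \<notin> I"
    using I by (simp add: interpretations_def)
  ultimately show "I \<in> {{PosLit v}, {NegLit v}}"
    by blast
qed (auto simp: interpretations_def)

lemma restrict_lits_interpretation:
  assumes "W \<subseteq> U" "I \<in> interpretations U"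
  shows "restrict_lits W I \<in> interpretations W"
  using assms by (auto simp: interpretations_def restrict_lits_def)

text \<open>For disjoint variable sets, a union of interpretations determines its two parts by
  restriction. This supplies the bijection in \<open>count_models_conj\<close>; disjointness of the
  parts lets the product over the union split.\<close>

lemma interpretations_Un:
  assumes "A \<in> interpretations V" "B \<in> interpretations W" "V \<inter> W = {}"
  shows "A \<union> B \<in> interpretations (V \<union> W)"
    "restrict_lits V (A \<union> B) = A" "restrict_lits W (A \<union> B) = B" "A \<inter> B = {}"
proof -
  have A: "A \<subseteq> {l. lit_var l \<in> V}" and B: "B \<subseteq> {l. lit_var l \<in> W}"
    using assms interpretation_subset by blast+
  show "restrict_lits V (A \<union> B) = A" "restrict_lits W (A \<union> B) = B" "A \<inter> B = {}"
    using A B assms(3) unfolding restrict_lits_def by blast+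
  have "PosLit v \<in> A \<union> B \<longleftrightarrow> NegLit v \<notin> A \<union> B" if "v \<in> V \<union> W" for v
  proof (cases "v \<in> V")
    case True
    \<comment> \<open>As \<open>B\<close> has no literal of a variable in \<open>V\<close>,
      membership in the union is decided by \<open>A\<close> alone.\<close>
    then have "PosLit v \<notin> B" "NegLit v \<notin> B" using B assms(3) by fastforce+
    then show ?thesis using True assms(1) by (simp add: interpretations_def)
  next
    case False
    then have "PosLit v \<notin> A" "NegLit v \<notin> A" using A by auto
    then show ?thesis using False that assms(2) by (simp add: interpretations_def)
  qed
  then show "A \<union> B \<in> interpretations (V \<union> W)"
    using A B unfolding interpretations_def by auto
qed

lemma restrict_lits_Un:
  "I \<in> interpretations (V \<union> W) \<Longrightarrow> restrict_lits V I \<union> restrict_lits W I = I"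
  by (auto simp: interpretations_def restrict_lits_def)

section \<open>Model counts of conjunctions and disjunctions\<close>

text \<open>Distributivity turns the product into a sum over pairs of models, and taking unions maps
  these pairs bijectively to the joint models. The assumptions on \<open>P\<close> and
  \<open>Q\<close> are locality: each depends only on the literals over its own variables.\<close>

lemma count_models_conj:
  fixes \<alpha> :: "'v literal \<Rightarrow> 'a::{comm_semiring_0, comm_monoid_mult}"
  assumes fin: "finite V" "finite W" and disj: "V \<inter> W = {}"
    and P: "\<And>I. P I = P (restrict_lits V I)" and Q: "\<And>I. Q I = Q (restrict_lits W I)"
  shows "count_models V \<alpha> P * count_models W \<alpha> Q = count_models (V \<union> W) \<alpha> (\<lambda>I. P I \<and> Q I)"
proof -
  let ?A = "{I. I \<in> interpretations V \<and> P I}" and ?B = "{I. I \<in> interpretations W \<and> Q I}"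
  have "count_models V \<alpha> P * count_models W \<alpha> Q = (\<Sum>(A, B)\<in>?A \<times> ?B. prod \<alpha> A * prod \<alpha> B)"
    by (simp add: count_models_def sum_product sum.cartesian_product)
  also have "\<dots> = (\<Sum>I | I \<in> interpretations (V \<union> W) \<and> P I \<and> Q I. prod \<alpha> I)"
  proof (rule sum.reindex_bij_witness[of _ "\<lambda>I. (restrict_lits V I, restrict_lits W I)" "\<lambda>(A, B). A \<union> B"])
    fix p assume "p \<in> ?A \<times> ?B"
    then obtain A B where p: "p = (A, B)" "A \<in> interpretations V" "P A" "B \<in> interpretations W" "Q B"
      by auto
    note U = interpretations_Un[OF p(2,4) disj]
    show "(restrict_lits V (case p of (A, B) \<Rightarrow> A \<union> B), restrict_lits W (case p of (A, B) \<Rightarrow> A \<union> B)) = p"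
      using U p by simp
    \<comment> \<open>Restricting the union gives back \<open>A\<close> and \<open>B\<close>, so
      locality transfers \<open>P A\<close> and \<open>Q B\<close> to the union.\<close>
    have "P (A \<union> B)" "Q (A \<union> B)"
      using P[of "A \<union> B"] Q[of "A \<union> B"] U p by simp_all
    then show "(case p of (A, B) \<Rightarrow> A \<union> B) \<in> {I. I \<in> interpretations (V \<union> W) \<and> P I \<and> Q I}"
      using U p by simp
    show "prod \<alpha> (case p of (A, B) \<Rightarrow> A \<union> B) = (case p of (A, B) \<Rightarrow> prod \<alpha> A * prod \<alpha> B)"
      using U p fin by (simp add: prod.union_disjoint finite_interpretation)
  next
    fix I assume I: "I \<in> {I. I \<in> interpretations (V \<union> W) \<and> P I \<and> Q I}"
    then show "(case (restrict_lits V I, restrict_lits W I) of (A, B) \<Rightarrow> A \<union> B) = I"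
      by (simp add: restrict_lits_Un)
    show "(restrict_lits V I, restrict_lits W I) \<in> ?A \<times> ?B"
      using I P[of I] Q[of I] restrict_lits_interpretation[of _ "V \<union> W" I] by auto
  qed
  finally show ?thesis
    by (simp add: count_models_def)
qed

text \<open>The model set of the disjunction is the union of the model sets over the common
  variables \<open>W\<close>; overlaps are absorbed by \<open>sum_UN_idem\<close>.\<close>

lemma count_models_disj:
  fixes \<alpha> :: "'v literal \<Rightarrow> 'a::{comm_semiring_0, comm_monoid_mult}"
  assumes idem: "\<And>a :: 'a. a + a = a" and "finite W" "finite F"
  shows "count_models W \<alpha> (\<lambda>I. \<exists>m\<in>F. P m I) = (\<Sum>m\<in>F. count_models W \<alpha> (P m))"
proof -
  have "{I. I \<in> interpretations W \<and> (\<exists>m\<in>F. P m I)} = (\<Union>m\<in>F. {I. I \<in> interpretations W \<and> P m I})"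
    by auto
  then show ?thesis
    using assms by (simp add: count_models_def sum_UN_idem[OF idem] finite_interpretations)
qed

lemma restrict_lits_mono: "V \<subseteq> W \<Longrightarrow> restrict_lits V (restrict_lits W I) = restrict_lits V I"
  by (auto simp: restrict_lits_def)

text \<open>Iterates \<open>count_models_conj\<close> by induction on \<open>F\<close>, splitting
  off one conjunct at a time.\<close>

lemma count_models_Ball:
  fixes \<alpha> :: "'v literal \<Rightarrow> 'a::{comm_semiring_0, comm_monoid_mult}"
  assumes "finite F" and "\<And>m. m \<in> F \<Longrightarrow> finite (W m)"
    and "\<And>m k. m \<in> F \<Longrightarrow> k \<in> F \<Longrightarrow> m \<noteq> k \<Longrightarrow> W m \<inter> W k = {}"
    and "\<And>m I. m \<in> F \<Longrightarrow> P m I = P m (restrict_lits (W m) I)"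
  shows "(\<Prod>m\<in>F. count_models (W m) \<alpha> (P m)) = count_models (\<Union>m\<in>F. W m) \<alpha> (\<lambda>I. \<forall>m\<in>F. P m I)"
  using assms
proof (induction F)
  case empty
  \<comment> \<open>Over no variables the only interpretation is the empty set, whose empty product
    is 1.\<close>
  then show ?case by (simp add: count_models_def interpretations_empty)
next
  case (insert x F)
  have IH: "(\<Prod>m\<in>F. count_models (W m) \<alpha> (P m)) = count_models (\<Union>m\<in>F. W m) \<alpha> (\<lambda>I. \<forall>m\<in>F. P m I)"
  proof (rule insert.IH)
    show "finite (W m)" if "m \<in> F" for m using that insert.prems(1) by simp
    show "W m \<inter> W k = {}" if "m \<in> F" "k \<in> F" "m \<noteq> k" for m k
      using that insert.prems(2) by simp
    show "P m I = P m (restrict_lits (W m) I)" if "m \<in> F" for m I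
      using that by (intro insert.prems(3)) simp
  qed
  \<comment> \<open>Locality of the remaining conjunction: restricting to the larger set first does
    not change the restriction to \<open>W m\<close>, on which \<open>P m\<close> depends.\<close>
  have "P m I = P m (restrict_lits (\<Union>m\<in>F. W m) I)" if "m \<in> F" for m I
  proof -
    have m: "m \<in> insert x F" using that by simp
    have "P m (restrict_lits (\<Union>m\<in>F. W m) I) = P m (restrict_lits (W m) (restrict_lits (\<Union>m\<in>F. W m) I))"
      by (rule insert.prems(3)[OF m])
    also have "restrict_lits (W m) (restrict_lits (\<Union>m\<in>F. W m) I) = restrict_lits (W m) I"
      using that by (intro restrict_lits_mono) blast
    also have "P m (restrict_lits (W m) I) = P m I"
      by (rule insert.prems(3)[OF m, symmetric])
    finally show ?thesis ..
  qed
  then have Q: "(\<forall>m\<in>F. P m I) = (\<forall>m\<in>F. P m (restrict_lits (\<Union>m\<in>F. W m) I))" for I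
    by blast
  have disj: "W x \<inter> (\<Union>m\<in>F. W m) = {}"
    using insert.prems(2)[of x] insert.hyps(2) by blast
  have "count_models (W x) \<alpha> (P x) * count_models (\<Union>m\<in>F. W m) \<alpha> (\<lambda>I. \<forall>m\<in>F. P m I) =
      count_models (W x \<union> (\<Union>m\<in>F. W m)) \<alpha> (\<lambda>I. P x I \<and> (\<forall>m\<in>F. P m I))"
  proof (rule count_models_conj[where Q = "\<lambda>I. \<forall>m\<in>F. P m I", OF _ _ disj _ Q])
    show "P x I = P x (restrict_lits (W x) I)" for I
      by (rule insert.prems(3)) simp
  qed (use insert.hyps(1) insert.prems(1) in auto)
  then show ?case
    using insert.hyps IH by simp
qed

section \<open>Variables and satisfaction at circuit nodes\<close>

text \<open>A path from \<open>n\<close> is either trivial or continues from a child of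
  \<open>n\<close>, so the reachable literal labels split accordingly.\<close>

lemma node_vars_rec:
  "node_vars N n = {lit_var l | l. label N n = LLit l} \<union> (\<Union>m\<in>children N n. node_vars N m)"
proof -
  have reach: "(n, k) \<in> (edges N)\<^sup>* \<longleftrightarrow> k = n \<or> (\<exists>m\<in>children N n. (m, k) \<in> (edges N)\<^sup>*)" for k
  proof
    assume "(n, k) \<in> (edges N)\<^sup>*"
    then show "k = n \<or> (\<exists>m\<in>children N n. (m, k) \<in> (edges N)\<^sup>*)"
      by (cases rule: converse_rtranclE) (auto simp: children_def)
  next
    assume "k = n \<or> (\<exists>m\<in>children N n. (m, k) \<in> (edges N)\<^sup>*)"
    then show "(n, k) \<in> (edges N)\<^sup>*"
      by (auto simp: children_def intro: converse_rtrancl_into_rtrancl)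
  qed
  show ?thesis
    unfolding node_vars_def reach by auto
qed

lemma
  assumes "nnf_circuit V N" "n \<in> nodes N"
  shows finite_node_vars: "finite (node_vars N n)"
    and finite_children: "finite (children N n)"
    and children_nodes: "children N n \<subseteq> nodes N"
proof -
  have fin: "finite (nodes N)" and E: "edges N \<subseteq> nodes N \<times> nodes N"
    using assms by (auto simp: nnf_circuit_def)
  have "m \<in> nodes N" if "(n, m) \<in> (edges N)\<^sup>*" for m
    using that assms(2) E by (induction rule: rtrancl_induct) auto
  \<comment> \<open>The \<open>case\<close> is unspecified at labels other than \<open>LLit\<close>;
    this is harmless, since only an inclusion in a finite image is claimed.\<close>
  then have "node_vars N n \<subseteq> (\<lambda>m. case label N m of LLit l \<Rightarrow> lit_var l) ` nodes N"
    by (force simp: node_vars_def)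
  with fin show "finite (node_vars N n)"
    using finite_surj by blast
  show sub: "children N n \<subseteq> nodes N"
    using E by (auto simp: children_def)
  with fin show "finite (children N n)"
    using finite_subset by blast
qed

text \<open>Satisfaction at \<open>n\<close> inspects only literals at leaves below
  \<open>n\<close>. Allowing any \<open>W\<close> that contains the variables of \<open>n\<close>
  keeps \<open>W\<close> fixed on passing to children. The case of \<open>W\<close> equal to the
  variables of a node is the locality required by \<open>count_models_Ball\<close>.\<close>

lemma node_sat_restrict_lits:
  assumes N: "nnf_circuit V N" and "node_vars N n \<subseteq> W"
  shows "node_sat N (restrict_lits W I) n = node_sat N I n"
  using assms(2)
proof (induction n rule: wf_induct_rule[OF nnf_circuit_wf[OF N]])
  case (1 n)
  have "node_sat N (restrict_lits W I) m = node_sat N I m" if "m \<in> children N n" for m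
  proof (rule 1(1))
    show "(m, n) \<in> (edges N)\<inverse>" using that by (simp add: children_def)
    show "node_vars N m \<subseteq> W" using that 1(2) node_vars_rec[of N n] by blast
  qed
  moreover have "l \<in> restrict_lits W I \<longleftrightarrow> l \<in> I" if "label N n = LLit l" for l
    using that 1(2) node_vars_rec[of N n] by (auto simp: restrict_lits_def)
  ultimately show ?case
    by (auto simp: node_sat_rec[OF N, of _ n] split: node_label.split)
qed

section \<open>Node values as model counts\<close>

lemma node_eval_eq_count_models:
  fixes \<alpha> :: "'v literal \<Rightarrow> 'a::{comm_semiring_0, comm_monoid_mult}"
  assumes idem: "\<And>a :: 'a. a + a = a"
    and N: "nnf_circuit V N" and "smooth N" "decomposable N" and "n \<in> nodes N"
  shows "node_eval N \<alpha> n = count_models (node_vars N n) \<alpha> (\<lambda>I. node_sat N I n)"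
  using \<open>n \<in> nodes N\<close>
proof (induction n rule: wf_induct_rule[OF nnf_circuit_wf[OF N]])
  case (1 n)
  have IH: "node_eval N \<alpha> m = count_models (node_vars N m) \<alpha> (\<lambda>I. node_sat N I m)"
    if "m \<in> children N n" for m
  proof (rule 1(1))
    show "(m, n) \<in> (edges N)\<inverse>" using that by (simp add: children_def)
    show "m \<in> nodes N" using that children_nodes[OF N 1(2)] by blast
  qed
  have lab: "if children N n = {} then label N n \<in> {LTop, LBot} \<union> LLit ` {l. lit_var l \<in> V}
      else label N n \<in> {LOr, LAnd}"
    using N unfolding nnf_circuit_def by (elim conjE) (rule bspec[OF _ 1(2)])
  note fin = finite_children[OF N 1(2)]
  note finv = finite_node_vars[OF N 1(2)]
  show ?case
  proof (cases "label N n")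
    case LTop
    then have "children N n = {}" using lab by (auto split: if_splits)
    with LTop have "node_vars N n = {}" by (simp add: node_vars_rec[of N n])
    with LTop show ?thesis
      by (simp add: node_eval_rec[OF N, of _ n] node_sat_rec[OF N, of _ n] count_models_def
          interpretations_empty)
  next
    case LBot
    \<comment> \<open>No interpretation satisfies this node, so the count is an empty sum, whatever
      its variables.\<close>
    then show ?thesis
      by (simp add: node_eval_rec[OF N, of _ n] node_sat_rec[OF N, of _ n] count_models_def)
  next
    case (LLit l)
    then have "children N n = {}" using lab by (auto split: if_splits)
    with LLit have vars: "node_vars N n = {lit_var l}" by (simp add: node_vars_rec[of N n])
    have "{I \<in> interpretations {lit_var l}. l \<in> I} = {{l}}"
      by (cases l) (auto simp: interpretations_singleton)
    with LLit vars show ?thesis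
      by (simp add: node_eval_rec[OF N, of _ n] node_sat_rec[OF N, of _ n] count_models_def)
  next
    case LOr
    \<comment> \<open>A childless node has a leaf label. Nonemptiness is required by
      \<open>SUP_eq_const\<close> below: a union of equal sets over a nonempty family equals each
      member.\<close>
    then have "children N n \<noteq> {}" using lab by (auto split: if_splits)
    moreover have vars: "node_vars N n = (\<Union>m\<in>children N n. node_vars N m)"
      using LOr by (simp add: node_vars_rec[of N n])
    moreover have "node_vars N m = node_vars N k" if "m \<in> children N n" "k \<in> children N n" for m k
      by (rule \<open>smooth N\<close>[unfolded smooth_def, rule_format, OF 1(2) LOr that])
    ultimately have same_vars: "node_vars N m = node_vars N n" if "m \<in> children N n" for m
      using that by (metis SUP_eq_const)
    \<comment> \<open>By smoothness all children can be counted over the variables of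
      \<open>n\<close>, the form in which \<open>count_models_disj\<close> applies.\<close>
    have "(\<Sum>m\<in>children N n. node_eval N \<alpha> m) =
        (\<Sum>m\<in>children N n. count_models (node_vars N n) \<alpha> (\<lambda>I. node_sat N I m))"
    proof (rule sum.cong)
      show "node_eval N \<alpha> m = count_models (node_vars N n) \<alpha> (\<lambda>I. node_sat N I m)"
        if "m \<in> children N n" for m
        unfolding IH[OF that] same_vars[OF that] ..
    qed simp
    with LOr show ?thesis
      by (simp add: node_eval_rec[OF N, of _ n] node_sat_rec[OF N, of _ n]
          count_models_disj[OF idem finv fin])
  next
    case LAnd
    have vars: "node_vars N n = (\<Union>m\<in>children N n. node_vars N m)"
      using LAnd by (simp add: node_vars_rec[of N n])
    have "(\<Prod>m\<in>children N n. count_models (node_vars N m) \<alpha> (\<lambda>I. node_sat N I m)) =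
        count_models (\<Union>m\<in>children N n. node_vars N m) \<alpha> (\<lambda>I. \<forall>m\<in>children N n. node_sat N I m)"
    proof (rule count_models_Ball[OF fin])
      show "finite (node_vars N m)" if "m \<in> children N n" for m
        using that children_nodes[OF N 1(2)] finite_node_vars[OF N] by auto
      show "node_vars N m \<inter> node_vars N k = {}"
        if "m \<in> children N n" "k \<in> children N n" "m \<noteq> k" for m k
        using that \<open>decomposable N\<close> 1(2) LAnd by (simp add: decomposable_def)
      show "node_sat N I m = node_sat N (restrict_lits (node_vars N m) I) m" for m I
        by (simp add: node_sat_restrict_lits[OF N])
    qed
    moreover have "node_eval N \<alpha> n = (\<Prod>m\<in>children N n. count_models (node_vars N m) \<alpha> (\<lambda>I. node_sat N I m))"
      unfolding node_eval_rec[OF N, of _ n] LAnd node_label.case by (rule prod.cong) (rule refl, rule IH)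
    moreover have "(\<lambda>I. node_sat N I n) = (\<lambda>I. \<forall>m\<in>children N n. node_sat N I m)"
      using LAnd by (simp add: node_sat_rec[OF N, of _ n])
    ultimately show ?thesis
      by (simp only: vars)
  qed
qed

theorem theorem3:
  fixes V :: "'v set"
    and T :: "'v form set"
    and \<alpha> :: "'v literal \<Rightarrow> 'a::{comm_semiring_0, comm_monoid_mult}"
    and N :: "('n, 'v) circuit"
  assumes "finite V"
    and "theory_over V T"
    and "\<And>a :: 'a. a + a = a"
    and "sdnnf_representation V T N"
  shows "Eval N \<alpha> = amc V \<alpha> T"
proof -
  have N: "nnf_circuit V N" "smooth N" "decomposable N" "circuit_models V N = models V T"
      "node_vars N (root_node N) = V"
    using assms(4) by (auto simp: sdnnf_representation_def)
  then have "root_node N \<in> nodes N" by (simp add: nnf_circuit_def)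
  from node_eval_eq_count_models[OF assms(3) N(1-3) this]
  have "Eval N \<alpha> = count_models V \<alpha> (\<lambda>I. node_sat N I (root_node N))"
    by (simp add: Eval_def N(5))
  \<comment> \<open>Logical equivalence of circuit and theory makes both sums range over the same
    interpretations of \<open>V\<close>.\<close>
  also have "\<dots> = amc V \<alpha> T"
    by (simp add: count_models_def amc_def circuit_models_def flip: N(4))
  finally show ?thesis .
qed

end
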